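(* Let $m_1,m_2,m_3,l_1,l_2,l_3>0$ be fixed and let $k_2=0$. There exists $K_1$ such that for any $k_1>K_1$ there exists $\varepsilon=\varepsilon(k_1)>0$ such that for all $F\in\mathbb{R}$ with $|F|<\varepsilon$ the system $$\dot\varphi_1=v_1,\qquad \dot v_1=\frac{A_{22}r_1-A_{12}r_2}{A_{11}A_{22}-A_{12}^2},\qquad \dot v_2=\frac{A_{11}r_2-A_{12}r_1}{A_{11}A_{22}-A_{12}^2}$$ in $\mathbb{R}^3$ with coordinates $(\varphi_1,v_1,v_2)$ has a two-parameter family of periodic solutions.
   Context: This is the reduced system of the Ziegler pendulum with zero stiffness $k_2=0$ of the spring at the pivot. Here $$A_{11}=m_1l_1^2+m_3l_3^2,$$ $$A_{12}=m_1l_1^2+m_3l_3^2+(m_1l_1-m_3l_3)l_2\cos\varphi_1,$$ $$A_{22}=(m_1+m_2+m_3)l_2^2+m_1l_1^2+m_3l_3^2+2(m_1l_1-m_3l_3)l_2\cos\varphi_1,$$ $$r_1=-k_1\varphi_1-(m_1l_1-m_3l_3)l_2v_2^2\sin\varphi_1,$$ $$r_2=-Fl_2\sin\varphi_1+(m_1l_1-m_3l_3)l_2v_1(v_1+2v_2)\sin\varphi_1.$$ One has $A_{11}A_{22}-A_{12}^2>0$ everywhere. A two-parameter family of periodic solutions means: there are a nonempty open set $U\subset\mathbb{R}^2$ and a smooth injective immersion $\sigma:U\to\mathbb{R}^3$, transverse to the vector field of the system, such that for each $u\in U$ the solution through $\sigma(u)$ is non-constant and periodic, and distinct $u$ give distinct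 trajectories. *)

theory Defs
  imports "HOL-Analysis.Analysis"
begin

section \<open>Families of periodic solutions of an autonomous vector field\<close>

text \<open>
  For open \<open>S\<close>, \<open>Ck_on n f S\<close> says that \<open>f\<close> is \<open>n\<close> times continuously differentiable on \<open>S\<close>:
  at successor steps all directional derivatives are required to be \<open>n - 1\<close> times continuously
  differentiable.
\<close>

primrec Ck_on :: "nat \<Rightarrow> ('a::real_normed_vector \<Rightarrow> 'b::real_normed_vector) \<Rightarrow> 'a set \<Rightarrow> bool" where
  "Ck_on 0 f S \<longleftrightarrow> continuous_on S f"
| "Ck_on (Suc n) f S \<longleftrightarrow>
     (\<forall>x\<in>S. f differentiable (at x)) \<and> (\<forall>v. Ck_on n (\<lambda>x. frechet_derivative f (at x) v) S)"

definition smooth_on :: "('a::real_normed_vector \<Rightarrow> 'b::real_normed_vector) \<Rightarrow> 'a set \<Rightarrow> bool" where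
  "smooth_on f S \<longleftrightarrow> (\<forall>n. Ck_on n f S)"

definition immersion_on :: "('a::real_normed_vector \<Rightarrow> 'b::real_normed_vector) \<Rightarrow> 'a set \<Rightarrow> bool" where
  "immersion_on f S \<longleftrightarrow> smooth_on f S \<and> (\<forall>x\<in>S. inj (frechet_derivative f (at x)))"

definition transverse_on ::
  "('a::real_normed_vector \<Rightarrow> 'b::real_normed_vector) \<Rightarrow> 'a set \<Rightarrow> ('b \<Rightarrow> 'b) \<Rightarrow> bool" where
  "transverse_on f S X \<longleftrightarrow>
     (\<forall>x\<in>S. span (insert (X (f x)) (range (frechet_derivative f (at x)))) = UNIV)"

definition global_solution :: "('b::real_normed_vector \<Rightarrow> 'b) \<Rightarrow> (real \<Rightarrow> 'b) \<Rightarrow> bool" where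
  "global_solution X \<gamma> \<longleftrightarrow> (\<forall>t. (\<gamma> has_vector_derivative X (\<gamma> t)) (at t))"

definition periodic :: "(real \<Rightarrow> 'b) \<Rightarrow> bool" where
  "periodic \<gamma> \<longleftrightarrow> (\<exists>T>0. \<forall>t. \<gamma> (t + T) = \<gamma> t)"

text \<open>
  \<open>\<gamma> u\<close> is the solution through \<open>\<sigma> u\<close> (unique when \<open>X\<close> is locally Lipschitz), and
  its trajectory is the set \<open>range (\<gamma> u)\<close>.
\<close>

definition has_two_parameter_family_of_periodic_solutions :: "(real^3 \<Rightarrow> real^3) \<Rightarrow> bool" where
  "has_two_parameter_family_of_periodic_solutions X \<longleftrightarrow>
     (\<exists>(U :: (real^2) set) (\<sigma> :: real^2 \<Rightarrow> real^3) (\<gamma> :: real^2 \<Rightarrow> real \<Rightarrow> real^3).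
        open U \<and> U \<noteq> {} \<and>
        inj_on \<sigma> U \<and> immersion_on \<sigma> U \<and> transverse_on \<sigma> U X \<and>
        (\<forall>u\<in>U. global_solution X (\<gamma> u) \<and> \<gamma> u 0 = \<sigma> u \<and>
               periodic (\<gamma> u) \<and> \<not> \<gamma> u constant_on UNIV) \<and>
        (\<forall>u\<in>U. \<forall>u'\<in>U. u \<noteq> u' \<longrightarrow> range (\<gamma> u) \<noteq> range (\<gamma> u')))"


section \<open>The reduced Ziegler pendulum with zero pivot stiffness\<close>

record ziegler =
  m1 :: real
  m2 :: real
  m3 :: real
  l1 :: real
  l2 :: real
  l3 :: real

definition A11 :: "ziegler \<Rightarrow> real" where
  "A11 p = m1 p * (l1 p)^2 + m3 p * (l3 p)^2"

definition A12 :: "ziegler \<Rightarrow> real \<Rightarrow> real" where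
  "A12 p \<phi>1 = m1 p * (l1 p)^2 + m3 p * (l3 p)^2
     + (m1 p * l1 p - m3 p * l3 p) * l2 p * cos \<phi>1"

definition A22 :: "ziegler \<Rightarrow> real \<Rightarrow> real" where
  "A22 p \<phi>1 = (m1 p + m2 p + m3 p) * (l2 p)^2 + m1 p * (l1 p)^2 + m3 p * (l3 p)^2
     + 2 * (m1 p * l1 p - m3 p * l3 p) * l2 p * cos \<phi>1"

definition r1 :: "ziegler \<Rightarrow> real \<Rightarrow> real \<Rightarrow> real \<Rightarrow> real" where
  "r1 p k1 \<phi>1 v2 = - k1 * \<phi>1 - (m1 p * l1 p - m3 p * l3 p) * l2 p * v2^2 * sin \<phi>1"

definition r2 :: "ziegler \<Rightarrow> real \<Rightarrow> real \<Rightarrow> real \<Rightarrow> real \<Rightarrow> real" where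
  "r2 p F \<phi>1 v1 v2 = - F * l2 p * sin \<phi>1
     + (m1 p * l1 p - m3 p * l3 p) * l2 p * v1 * (v1 + 2 * v2) * sin \<phi>1"

text \<open>The coordinates of the state \<open>x\<close> are \<open>(\<phi>1, v1, v2)\<close>.\<close>

definition ziegler_field :: "ziegler \<Rightarrow> real \<Rightarrow> real \<Rightarrow> real^3 \<Rightarrow> real^3" where
  "ziegler_field p k1 F x =
     (let \<phi>1 = x $ 1; v1 = x $ 2; v2 = x $ 3;
          D = A11 p * A22 p \<phi>1 - (A12 p \<phi>1)^2
      in vector
        [v1,
         (A22 p \<phi>1 * r1 p k1 \<phi>1 v2 - A12 p \<phi>1 * r2 p F \<phi>1 v1 v2) / D,
         (A11 p * r2 p F \<phi>1 v1 v2 - A12 p \<phi>1 * r1 p k1 \<phi>1 v2) / D])"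

end

theory Submission
  imports Defs
begin

text \<open>
  The system is reversible. The involution of phase space that changes the sign of \<open>\<phi>1\<close> and keeps
  \<open>v1\<close> and \<open>v2\<close> carries solutions to solutions with time reversed, and the set of its fixed points is
  the whole plane \<open>\<phi>1 = 0\<close>. A solution segment with both ends in this plane therefore fits together
  with its mirror image to a closed orbit (\<open>reversible_orbit_closes_up\<close>). Since the plane has
  dimension two and is transverse to the field wherever \<open>v1 \<noteq> 0\<close>, an open piece of it
  parametrises the family, as soon as the solutions that start there come back to the plane.

  They come back if they start near the equilibrium at the origin. For \<open>\<phi>1 \<ge> 0\<close> the spring
  contributes \<open>- A22 k1 \<phi>1 / det\<close> to the acceleration of \<open>\<phi>1\<close>, while every other contribution
  is \<open>sin \<phi>1\<close> times a factor that is small with \<open>F\<close> and the velocities. So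
  \<open>\<phi>1'' \<le> - \<omega>\<^sup>2 \<phi>1\<close> for some \<open>\<omega> > 0\<close> (\<open>restoring_acceleration\<close>), and comparison with
  \<open>sin (\<omega> t)\<close> forces a zero of \<open>\<phi>1\<close> no later than at time \<open>\<pi> / \<omega>\<close> (\<open>first_return_before_half_period\<close>).
  This argument applies to every positive stiffness, so \<open>K1 = 0\<close> will do.

  The solutions are obtained by truncating the field outside a ball, which makes it globally
  Lipschitz (\<open>lipschitz_ode_solution\<close>). As the origin is an equilibrium, solutions grow at most
  exponentially in proportion to their initial value, so those that start close enough to the
  origin stay in the ball up to the time \<open>\<pi> / \<omega>\<close> and solve the original system.

  Finally, along one period such an orbit meets the half-plane \<open>\<phi>1 = 0\<close>, \<open>v1 > 0\<close> at its starting
  point only: \<open>\<phi>1\<close> is positive on the first half and negative on the mirror image, and at the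
  turn between them \<open>v1 \<le> 0\<close>. Hence different starting points have different trajectories.
\<close>

section \<open>Solutions of globally Lipschitz differential equations\<close>

text \<open>
  Picard iteration in the norm weighted by \<open>exp (- 2 L t)\<close>: with this weight the integral operator
  contracts by the factor \<open>1/2\<close> on an interval of any length, so a single application of the Banach
  fixed point theorem covers \<open>[0, T]\<close>. The growth bound comes from the same estimate: a fixed
  point has weighted norm at most \<open>1 / (1 - 1/2)\<close> times that of the image of \<open>0\<close>, which is
  \<open>norm x0\<close> because \<open>f 0 = 0\<close>.
\<close>

lemma lipschitz_ode_solution:
  fixes f :: "'a::euclidean_space \<Rightarrow> 'a"
  assumes lip: "L-lipschitz_on UNIV f" and "L > 0" and f0: "f 0 = 0" and "T \<ge> 0"
  obtains x where "x 0 = x0"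
    and "\<And>t. t \<in> {0..T} \<Longrightarrow> (x has_vector_derivative f (x t)) (at t within {0..T})"
    and "\<And>t. t \<in> {0..T} \<Longrightarrow> norm (x t) \<le> 2 * norm x0 * exp (2 * L * t)"
proof -
  define K where "K = 2 * L"
  have "K > 0" using \<open>L > 0\<close> by (simp add: K_def)
  \<comment> \<open>Functions on \<open>{0..T}\<close> are represented by bounded continuous functions on the real line, by
      clamping the time to \<open>{0..T}\<close>.\<close>
  define c where "c t = max 0 (min t T)" for t :: real
  have c_in: "c t \<in> {0..T}" for t using \<open>T \<ge> 0\<close> by (auto simp: c_def)
  have c_id: "c t = t" if "t \<in> {0..T}" for t using that by (auto simp: c_def)
  have c_cont: "continuous_on UNIV c"
    unfolding c_def by (intro continuous_intros)
  \<comment> \<open>The unknown is \<open>y t = exp (- K * t) *\<^sub>R x t\<close>, so that the weighted norm of \<open>x\<close> is the supremum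
      norm of \<open>y\<close>.\<close>
  define g where "g y r = f (exp (K * r) *\<^sub>R y r)" for y :: "real \<Rightarrow> 'a" and r
  define \<Phi> where "\<Phi> y t = exp (- K * c t) *\<^sub>R (x0 + integral {0..c t} (g y))" for y t
  have f_cont: "continuous_on S f" for S
    using lipschitz_on_continuous_on[OF lip] continuous_on_subset by blast
  have g_cont: "continuous_on S (g y)" if "continuous_on UNIV y" for y S
  proof -
    have "continuous_on UNIV (\<lambda>r. exp (K * r) *\<^sub>R y r)"
      using that by (intro continuous_intros)
    then have "continuous_on UNIV (g y)"
      unfolding g_def using continuous_on_compose2[OF f_cont[of UNIV]] by blast
    then show ?thesis using continuous_on_subset by blast
  qed
  have g_int: "g y integrable_on {a..b}" if "continuous_on UNIV y" for y a b
    by (rule integrable_continuous_real[OF g_cont[OF that]])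
  have \<Phi>_cont: "continuous_on UNIV (\<Phi> y)" if "continuous_on UNIV y" for y
  proof -
    have "continuous_on {0..T} (\<lambda>s. integral {0..s} (g y))"
      by (rule indefinite_integral_continuous_1[OF g_int[OF that]])
    then have "continuous_on UNIV (\<lambda>t. integral {0..c t} (g y))"
      by (rule continuous_on_compose2[OF _ c_cont]) (use c_in in blast)
    then show ?thesis
      unfolding \<Phi>_def by (intro continuous_intros c_cont)
  qed
  have range_\<Phi>: "range (\<Phi> y) \<subseteq> \<Phi> y ` {0..T}" for y
  proof
    fix z assume "z \<in> range (\<Phi> y)"
    then obtain t where "z = \<Phi> y t" by auto
    moreover have "\<Phi> y t = \<Phi> y (c t)"
      unfolding \<Phi>_def using c_id[OF c_in[of t]] by simp
    ultimately show "z \<in> \<Phi> y ` {0..T}" using c_in by blast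
  qed
  have \<Phi>_bcont: "\<Phi> y \<in> bcontfun" if "continuous_on UNIV y" for y
  proof -
    have "compact (\<Phi> y ` {0..T})"
      by (rule compact_continuous_image[OF continuous_on_subset[OF \<Phi>_cont[OF that]]]) auto
    then have "bounded (range (\<Phi> y))"
      by (rule bounded_subset[OF compact_imp_bounded range_\<Phi>])
    then show ?thesis using \<Phi>_cont[OF that] by (simp add: bcontfun_def)
  qed
  have g_diff: "norm (integral {0..s} (g y) - integral {0..s} (g z)) \<le> exp (K * s) * (d / 2)"
    if y: "continuous_on UNIV y" and z: "continuous_on UNIV z"
      and d: "\<And>r. dist (y r) (z r) \<le> d" and s: "s \<ge> 0" for y z d s
  proof -
    have "d \<ge> 0" using d[of 0] zero_le_dist[of "y 0" "z 0"] by linarith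
    have E: "((\<lambda>r. L * d * exp (K * r)) has_integral
              (L * d * exp (K * s) / K - L * d * exp (K * 0) / K)) {0..s}"
      by (rule fundamental_theorem_of_calculus[OF s])
         (auto intro!: derivative_eq_intros simp flip: has_real_derivative_iff_has_vector_derivative
           simp: \<open>K > 0\<close>[THEN less_imp_neq, symmetric])
    have "norm (integral {0..s} (g y) - integral {0..s} (g z)) =
          norm (integral {0..s} (\<lambda>r. g y r - g z r))"
      by (simp add: Henstock_Kurzweil_Integration.integral_diff g_int y z)
    also have "\<dots> \<le> integral {0..s} (\<lambda>r. L * d * exp (K * r))"
    proof (rule Henstock_Kurzweil_Integration.integral_norm_bound_integral)
      show "(\<lambda>r. g y r - g z r) integrable_on {0..s}"
        by (intro integrable_diff g_int y z)
      show "(\<lambda>r. L * d * exp (K * r)) integrable_on {0..s}" using E by blast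
      fix r
      have "norm (g y r - g z r) \<le> L * norm (exp (K * r) *\<^sub>R y r - exp (K * r) *\<^sub>R z r)"
        unfolding g_def by (rule lipschitz_on_normD[OF lip]) auto
      also have "\<dots> = L * (exp (K * r) * dist (y r) (z r))"
        by (simp add: dist_norm flip: scaleR_diff_right)
      also have "\<dots> \<le> L * (exp (K * r) * d)"
        using d[of r] \<open>L > 0\<close> by (intro mult_left_mono) auto
      finally show "norm (g y r - g z r) \<le> L * d * exp (K * r)" by (simp add: mult_ac)
    qed
    also have "\<dots> = L * d * exp (K * s) / K - L * d / K"
      using integral_unique[OF E] by simp
    also have "\<dots> \<le> L * d * exp (K * s) / K"
      using \<open>L > 0\<close> \<open>K > 0\<close> \<open>d \<ge> 0\<close> by simp
    also have "\<dots> = exp (K * s) * (d / 2)"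
      using \<open>L > 0\<close> by (simp add: K_def)
    finally show ?thesis .
  qed
  define F where "F y = Bcontfun (\<Phi> (apply_bcontfun y))" for y
  have F_apply: "apply_bcontfun (F y) = \<Phi> (apply_bcontfun y)" for y
    unfolding F_def by (rule Bcontfun_inverse[OF \<Phi>_bcont]) simp
  have "dist (F y) (F z) \<le> 1 / 2 * dist y z" for y z
  proof (rule dist_bound)
    fix t
    have "dist (F y t) (F z t) =
       norm (exp (- K * c t) *\<^sub>R (integral {0..c t} (g y) - integral {0..c t} (g z)))"
      unfolding F_apply \<Phi>_def dist_norm scaleR_diff_right[symmetric] by simp
    also have "\<dots> \<le> exp (- K * c t) * (exp (K * c t) * (dist y z / 2))"
      unfolding norm_scaleR abs_exp_cancel using c_in[of t]
      by (intro mult_left_mono g_diff dist_bounded) auto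
    also have "\<dots> = 1 / 2 * dist y z" by (simp add: exp_minus)
    finally show "dist (F y t) (F z t) \<le> 1 / 2 * dist y z" .
  qed
  then have "\<exists>!y. F y = y"
    by (intro banach_fix_type[of "1/2"]) auto
  then obtain y where y: "F y = y" by blast
  define x where "x t = exp (K * t) *\<^sub>R y t" for t
  have x_eq: "x t = x0 + integral {0..t} (\<lambda>r. f (x r))" if "t \<in> {0..T}" for t
  proof -
    have "y t = \<Phi> y t" using F_apply[of y] y by simp
    then show ?thesis
      using c_id[OF that] unfolding x_def \<Phi>_def g_def by (simp add: exp_minus)
  qed
  have fx: "continuous_on {0..T} (\<lambda>r. f (x r))"
    using g_cont[of y "{0..T}"] by (simp add: g_def[abs_def] x_def)
  show thesis
  proof
    show "x 0 = x0" using x_eq[of 0] \<open>T \<ge> 0\<close> by simp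
    fix t assume t: "t \<in> {0..T}"
    have "((\<lambda>u. x0 + integral {0..u} (\<lambda>r. f (x r))) has_vector_derivative f (x t)) (at t within {0..T})"
      using integral_has_vector_derivative[OF fx t] by (auto intro!: derivative_eq_intros)
    then show "(x has_vector_derivative f (x t)) (at t within {0..T})"
      by (rule has_vector_derivative_transform[OF t, rotated]) (simp add: x_eq)
    have "norm (y s) \<le> norm x0 + dist y 0 / 2" for s
    proof -
      have "integral {0..c s} (g (\<lambda>_. 0)) = 0" by (simp add: g_def[abs_def] f0)
      then have "norm (integral {0..c s} (g y)) \<le> exp (K * c s) * (dist y 0 / 2)"
        using g_diff[of y "\<lambda>_. 0" "dist y 0" "c s"] dist_bounded[of y _ 0] c_in[of s]
        by (simp add: dist_norm)
      then have "norm (x0 + integral {0..c s} (g y)) \<le> norm x0 + exp (K * c s) * (dist y 0 / 2)"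
        by (meson add_left_mono norm_triangle_ineq order_trans)
      then have "norm (\<Phi> y s) \<le> exp (- K * c s) * (norm x0 + exp (K * c s) * (dist y 0 / 2))"
        unfolding \<Phi>_def norm_scaleR by (auto intro!: mult_left_mono)
      also have "\<dots> = exp (- K * c s) * norm x0 + dist y 0 / 2"
        by (simp add: exp_minus algebra_simps)
      also have "\<dots> \<le> norm x0 + dist y 0 / 2"
        using c_in[of s] \<open>K > 0\<close> by (simp add: mult_left_le_one_le)
      finally show ?thesis using F_apply[of y] y by simp
    qed
    then have "dist y 0 \<le> norm x0 + dist y 0 / 2"
      by (intro dist_bound) auto
    then have "dist y 0 \<le> 2 * norm x0" by simp
    then have "norm (y t) \<le> 2 * norm x0"
      using dist_bounded[of y t 0] by simp
    then show "norm (x t) \<le> 2 * norm x0 * exp (2 * L * t)"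
      unfolding x_def norm_scaleR by (simp add: K_def mult_ac)
  qed
qed

section \<open>Closed orbits of reversible vector fields\<close>

lemma has_vector_derivative_at_if_one_sided:
  fixes f :: "real \<Rightarrow> 'a::real_normed_vector"
  assumes "(f has_vector_derivative d) (at b within {a..b})"
    and "(f has_vector_derivative d) (at b within {b..c})" and "a < b" "b < c"
  shows "(f has_vector_derivative d) (at b)"
proof -
  have "{a..b} \<union> {b..c} = {a..c}" using assms(3,4) by auto
  then have eq: "at b within {a..c} = sup (at b within {a..b}) (at b within {b..c})"
    using at_within_union[of b "{a..b}" "{b..c}"] by simp
  have "(f has_vector_derivative d) (at b within {a..c})"
    using assms(1,2) unfolding has_vector_derivative_def has_derivative_within unfolding eq
    by (blast intro: filterlim_sup)
  then show ?thesis using at_within_Icc_at[OF assms(3,4)] by simp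
qed

text \<open>
  The solution runs from one fixed point of \<open>R\<close> to another. Its image under \<open>R\<close>, run backwards,
  leads from the second one to the first, and alternating the two gives a solution of period
  \<open>2 * T\<close>. The pieces agree at the junctions because the endpoints are fixed by \<open>R\<close>, and since both
  then satisfy the same differential equation, their one-sided derivatives agree as well.
\<close>

lemma reversible_orbit_closes_up:
  fixes X :: "'a::real_normed_vector \<Rightarrow> 'a"
  assumes R: "bounded_linear R" and rev: "\<And>z. X (R z) = - R (X z)" and "T > 0"
    and x: "\<And>t. t \<in> {0..T} \<Longrightarrow> (x has_vector_derivative X (x t)) (at t within {0..T})"
    and fix0: "R (x 0) = x 0" and fixT: "R (x T) = x T"
  obtains \<gamma> where "global_solution X \<gamma>" "\<And>t. \<gamma> (t + 2 * T) = \<gamma> t" "\<And>t. t \<in> {0..T} \<Longrightarrow> \<gamma> t = x t"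
    "range \<gamma> \<subseteq> x ` {0..T} \<union> R ` x ` {0..T}"
proof -
  define I where "I n = {of_int n * T .. (of_int n + 1) * T}" for n :: int
  \<comment> \<open>The \<open>n\<close>-th copy, on the interval \<open>I n\<close>.\<close>
  define piece where "piece n t =
      (if even n then x (t - of_int n * T) else R (x ((of_int n + 1) * T - t)))" for n :: int and t
  define \<gamma> where "\<gamma> t = piece \<lfloor>t / T\<rfloor> t" for t
  have in_I: "t \<in> I \<lfloor>t / T\<rfloor>" for t
  proof -
    have "of_int \<lfloor>t / T\<rfloor> \<le> t / T" "t / T \<le> of_int \<lfloor>t / T\<rfloor> + 1" by linarith+
    then show ?thesis
      unfolding I_def pos_le_divide_eq[OF \<open>T > 0\<close>] pos_divide_le_eq[OF \<open>T > 0\<close>] by simp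
  qed
  have \<gamma>_eq: "\<gamma> t = piece n t" if "t \<in> I n" for n t
  proof (cases "t = (of_int n + 1) * T")
    case True
    then have "\<lfloor>t / T\<rfloor> = n + 1" using \<open>T > 0\<close> by simp
    then show ?thesis unfolding \<gamma>_def
      using True fix0 fixT by (auto simp: piece_def algebra_simps)
  next
    case False
    then have "of_int n \<le> t / T" "t / T < of_int n + 1"
      using that \<open>T > 0\<close> by (auto simp: I_def field_simps)
    then have "\<lfloor>t / T\<rfloor> = n" by (simp add: floor_unique)
    then show ?thesis by (simp add: \<gamma>_def)
  qed
  have piece_deriv: "(piece n has_vector_derivative X (piece n t)) (at t within I n)"
    if t: "t \<in> I n" for n t
  proof (cases "even n")
    case True
    have sub: "(\<lambda>s. s - of_int n * T) ` I n \<subseteq> {0..T}" by (auto simp: I_def algebra_simps)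
    have "((\<lambda>s. s - of_int n * T) has_vector_derivative 1) (at t within I n)"
      by (auto intro!: derivative_eq_intros)
    moreover have "(x has_vector_derivative X (x (t - of_int n * T)))
        (at (t - of_int n * T) within (\<lambda>s. s - of_int n * T) ` I n)"
      using has_vector_derivative_within_subset[OF x sub] t sub by blast
    ultimately have "(x \<circ> (\<lambda>s. s - of_int n * T) has_vector_derivative
        1 *\<^sub>R X (x (t - of_int n * T))) (at t within I n)"
      by (rule vector_diff_chain_within)
    then show ?thesis using True by (simp add: piece_def[abs_def] o_def)
  next
    case False
    have sub: "(\<lambda>s. (of_int n + 1) * T - s) ` I n \<subseteq> {0..T}" by (auto simp: I_def algebra_simps)
    have "((\<lambda>s. (of_int n + 1) * T - s) has_vector_derivative - 1) (at t within I n)"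
      by (auto intro!: derivative_eq_intros)
    moreover have "(x has_vector_derivative X (x ((of_int n + 1) * T - t)))
        (at ((of_int n + 1) * T - t) within (\<lambda>s. (of_int n + 1) * T - s) ` I n)"
      using has_vector_derivative_within_subset[OF x sub] t sub by blast
    ultimately have "(x \<circ> (\<lambda>s. (of_int n + 1) * T - s) has_vector_derivative
        (- 1) *\<^sub>R X (x ((of_int n + 1) * T - t))) (at t within I n)"
      by (rule vector_diff_chain_within)
    from bounded_linear.has_vector_derivative[OF R this] show ?thesis
      using False by (simp add: piece_def[abs_def] o_def rev linear_simps[OF R])
  qed
  have \<gamma>_deriv: "(\<gamma> has_vector_derivative X (\<gamma> t)) (at t within I n)" if "t \<in> I n" for n t
    using has_vector_derivative_transform[OF that \<gamma>_eq piece_deriv[OF that]] \<gamma>_eq[OF that] by simp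
  show thesis
  proof
    show "global_solution X \<gamma>"
      unfolding global_solution_def
    proof
      fix t
      define n where "n = \<lfloor>t / T\<rfloor>"
      have t: "t \<in> I n" using in_I by (simp add: n_def)
      have ne: "t \<noteq> (of_int n + 1) * T"
      proof -
        have "t / T < of_int n + 1" unfolding n_def by linarith
        then show ?thesis unfolding pos_divide_less_eq[OF \<open>T > 0\<close>] by simp
      qed
      show "(\<gamma> has_vector_derivative X (\<gamma> t)) (at t)"
      proof (cases "t = of_int n * T")
        case True
        have "t \<in> I (n - 1)" using True \<open>T > 0\<close> by (simp add: I_def algebra_simps)
        from \<gamma>_deriv[OF this] \<gamma>_deriv[OF t] show ?thesis
          unfolding I_def
          using True \<open>T > 0\<close>
          by (intro has_vector_derivative_at_if_one_sided
              [of _ _ t "of_int (n - 1) * T" "(of_int n + 1) * T"])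
            (simp_all add: algebra_simps)
      next
        case False
        then have "of_int n * T < t" "t < (of_int n + 1) * T" using t ne by (auto simp: I_def)
        then show ?thesis using \<gamma>_deriv[OF t] unfolding I_def by (simp add: at_within_Icc_at)
      qed
    qed
    show "\<gamma> (t + 2 * T) = \<gamma> t" for t
    proof -
      have "(t + 2 * T) / T = t / T + of_int 2" using \<open>T > 0\<close> by (simp add: field_simps)
      then have "\<lfloor>(t + 2 * T) / T\<rfloor> = \<lfloor>t / T\<rfloor> + 2" by (metis floor_add_int)
      then show ?thesis by (simp add: \<gamma>_def piece_def algebra_simps)
    qed
    show "\<gamma> t = x t" if "t \<in> {0..T}" for t
      using \<gamma>_eq[of t 0] that by (simp add: I_def piece_def)
    show "range \<gamma> \<subseteq> x ` {0..T} \<union> R ` x ` {0..T}"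
    proof
      fix z assume "z \<in> range \<gamma>"
      then obtain t where z: "z = \<gamma> t" by blast
      define n where "n = \<lfloor>t / T\<rfloor>"
      have t: "t \<in> I n" using in_I by (simp add: n_def)
      have "z = piece n t" using z \<gamma>_eq[OF t] by simp
      moreover have "t - of_int n * T \<in> {0..T}" "(of_int n + 1) * T - t \<in> {0..T}"
        using t by (auto simp: I_def algebra_simps)
      ultimately show "z \<in> x ` {0..T} \<union> R ` x ` {0..T}"
        by (auto simp: piece_def)
    qed
  qed
qed

section \<open>The first zero under a restoring acceleration\<close>

text \<open>
  Sturm comparison of \<open>q'' \<le> - \<omega>\<^sup>2 q\<close> with \<open>sin (\<omega> t)\<close>. If \<open>q\<close> were positive on \<open>(0, \<pi> / \<omega>]\<close>, the
  Wronskian of the two would be nonincreasing on this interval; it vanishes at \<open>0\<close>, but equals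
  \<open>\<omega> * q (\<pi> / \<omega>) > 0\<close> at the right end.
\<close>

lemma first_return_before_half_period:
  fixes q v w :: "real \<Rightarrow> real"
  assumes "\<omega> > 0" and T: "T = pi / \<omega>"
    and q: "\<And>t. t \<in> {0..T} \<Longrightarrow> (q has_real_derivative v t) (at t within {0..T})"
    and v: "\<And>t. t \<in> {0..T} \<Longrightarrow> (v has_real_derivative w t) (at t within {0..T})"
    and w: "\<And>t. t \<in> {0..T} \<Longrightarrow> q t \<ge> 0 \<Longrightarrow> w t \<le> - \<omega>\<^sup>2 * q t"
    and q0: "q 0 = 0" and v0: "v 0 > 0"
  obtains S where "S > 0" "S \<le> T" "q S = 0" "\<And>t. 0 < t \<Longrightarrow> t < S \<Longrightarrow> q t > 0" "v S \<le> 0"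
proof -
  have "T > 0" using \<open>\<omega> > 0\<close> T by simp
  have q_cont: "continuous_on {0..T} q" and v_cont: "continuous_on {0..T} v"
    by (rule DERIV_continuous_on, rule q v, assumption)+
  have "\<exists>t\<in>{0<..T}. q t \<le> 0"
  proof (rule ccontr)
    assume "\<not> ?thesis"
    then have pos: "q t > 0" if "0 < t" "t \<le> T" for t using that by force
    define W where "W t = v t * sin (\<omega> * t) - q t * (\<omega> * cos (\<omega> * t))" for t
    have "W 0 \<ge> W T"
    proof (rule DERIV_nonpos_imp_decreasing_open[of 0 T W])
      show "0 \<le> T" using \<open>T > 0\<close> by simp
      show "continuous_on {0..T} W"
        unfolding W_def by (intro continuous_intros q_cont v_cont)
      fix t assume t: "0 < t" "t < T"
      have "(q has_real_derivative v t) (at t)" "(v has_real_derivative w t) (at t)"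
        using q[of t] v[of t] t by (simp_all add: at_within_Icc_at)
      then have "(W has_real_derivative sin (\<omega> * t) * (w t + \<omega>\<^sup>2 * q t)) (at t)"
        unfolding W_def
        by (auto intro!: derivative_eq_intros simp: algebra_simps power2_eq_square)
      moreover have "sin (\<omega> * t) \<ge> 0"
        using t \<open>\<omega> > 0\<close> T by (intro sin_ge_zero) (auto simp: field_simps)
      then have "sin (\<omega> * t) * (w t + \<omega>\<^sup>2 * q t) \<le> 0"
        using w[of t] pos[of t] t by (intro mult_nonneg_nonpos) auto
      ultimately show "\<exists>y. (W has_real_derivative y) (at t) \<and> y \<le> 0" by blast
    qed
    moreover have "W 0 = 0" "W T = \<omega> * q T" using q0 \<open>\<omega> > 0\<close> by (auto simp: W_def T)
    ultimately show False using pos[of T] \<open>T > 0\<close> \<open>\<omega> > 0\<close> by (simp add: mult_le_0_iff)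
  qed
  then obtain t1 where t1: "0 < t1" "t1 \<le> T" "q t1 \<le> 0" by auto
  obtain e where e: "e > 0" "\<And>h. 0 < h \<Longrightarrow> h \<le> T \<Longrightarrow> h < e \<Longrightarrow> q h > 0"
    using has_real_derivative_pos_inc_right[OF q[of 0] v0] \<open>T > 0\<close> q0 by auto
  \<comment> \<open>By the choice of \<open>e\<close>, the zeros of \<open>q\<close> after time \<open>0\<close> form the compact set \<open>Z\<close>, so that there
      is a first one.\<close>
  define Z where "Z = {e..T} \<inter> q -` {0}"
  have zero_before: "\<exists>z\<in>Z. z \<le> t" if t: "0 < t" "t \<le> T" "q t \<le> 0" for t
  proof -
    have "e \<le> t" using e(2)[of t] t by force
    then have "q (e / 2) > 0" using e(1) t by (intro e(2)) auto
    moreover have "continuous_on {e / 2..t} q"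
      using q_cont t e(1) by (auto intro: continuous_on_subset)
    ultimately obtain z where z: "e / 2 \<le> z" "z \<le> t" "q z = 0"
      using IVT2'[of q t 0 "e / 2"] t \<open>e \<le> t\<close> e(1) by auto
    then have "e \<le> z" using e(1) e(2)[of z] t by force
    then show ?thesis using z t by (auto simp: Z_def)
  qed
  have "closed Z"
    unfolding Z_def using e(1)
    by (intro continuous_closed_preimage continuous_on_subset[OF q_cont]) auto
  then have "compact Z" by (simp add: Z_def compact_eq_bounded_closed bounded_Int)
  moreover have "Z \<noteq> {}" using zero_before[OF t1] by blast
  ultimately obtain S where S: "S \<in> Z" and least: "\<And>t. t \<in> Z \<Longrightarrow> S \<le> t"
    using compact_attains_inf[of Z] by blast
  have S': "0 < S" "S \<le> T" "q S = 0" using S e(1) by (auto simp: Z_def)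
  have pos: "q t > 0" if "0 < t" "t < S" for t
    using zero_before[of t] least that S' by force
  have "v S \<le> 0"
  proof (rule ccontr)
    assume "\<not> ?thesis"
    then obtain d where d: "d > 0" "\<And>h. 0 < h \<Longrightarrow> S - h \<in> {0..T} \<Longrightarrow> h < d \<Longrightarrow> q (S - h) < q S"
      using has_real_derivative_pos_inc_left[OF q[of S]] S' by auto
    define h where "h = min (d / 2) (S / 2)"
    have "0 < h" "h < d" "S - h \<in> {0..T}" "0 < S - h" "S - h < S" using d(1) S' by (auto simp: h_def min_def)
    then show False using d(2)[of h] pos[of "S - h"] S'(3) by force
  qed
  then show thesis using that S' pos by blast
qed

section \<open>The plane of symmetry as parameter domain\<close>

lemma Ck_on_const: "Ck_on n (\<lambda>x. c) S"
  by (induction n arbitrary: c) auto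

lemma bounded_linear_imp_smooth_on:
  assumes "bounded_linear f" shows "smooth_on f S"
  unfolding smooth_on_def
proof
  fix n
  have D: "frechet_derivative f (at x) = f" for x
    using frechet_derivative_at[OF bounded_linear_imp_has_derivative[OF assms]] by simp
  show "Ck_on n f S"
    using assms
    by (cases n) (auto simp: D Ck_on_const linear_continuous_on bounded_linear_imp_differentiable)
qed

definition flip :: "real^3 \<Rightarrow> real^3" where
  "flip z = vector [- z $ 1, z $ 2, z $ 3]"

lemma flip_nth [simp]: "flip z $ 1 = - z $ 1" "flip z $ 2 = z $ 2" "flip z $ 3 = z $ 3"
  by (simp_all add: flip_def)

lemma bounded_linear_flip: "bounded_linear flip"
  by (intro linear_conv_bounded_linear[THEN iffD1] linearI)
     (simp_all add: vec_eq_iff forall_3)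

lemma flip_fixed: "z $ 1 = 0 \<Longrightarrow> flip z = z"
  by (simp add: vec_eq_iff forall_3)

text \<open>
  The parametrisation of the plane \<open>\<phi>1 = 0\<close>, which is the set of fixed points of \<open>flip\<close>.
\<close>

definition slice :: "real^2 \<Rightarrow> real^3" where
  "slice u = vector [0, u $ 1, u $ 2]"

lemma slice_nth [simp]: "slice u $ 1 = 0" "slice u $ 2 = u $ 1" "slice u $ 3 = u $ 2"
  by (simp_all add: slice_def)

lemma bounded_linear_slice: "bounded_linear slice"
  by (intro linear_conv_bounded_linear[THEN iffD1] linearI)
     (simp_all add: vec_eq_iff forall_3)

lemma inj_slice: "inj slice"
  by (rule injI) (simp add: vec_eq_iff forall_2 forall_3)

lemma frechet_derivative_slice: "frechet_derivative slice (at u) = slice"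
  using frechet_derivative_at[OF bounded_linear_imp_has_derivative[OF bounded_linear_slice]]
  by simp

text \<open>
  The half-disc \<open>\<phi>1 = 0\<close>, \<open>v1 > 0\<close>, \<open>norm z < \<delta>\<close> of starting points serves as parameter domain.
  It is transverse to the field because the \<open>\<phi>1\<close>-component of the field is \<open>v1\<close>. The sign conditions on the first return recover the starting
  point from the trajectory, which therefore determines the parameter.
\<close>

lemma two_parameter_family_if_returns:
  fixes X :: "real^3 \<Rightarrow> real^3"
  assumes X1: "\<And>z. X z $ 1 = z $ 2" and rev: "\<And>z. X (flip z) = - flip (X z)" and "\<delta> > 0"
    and returns: "\<And>z. z $ 1 = 0 \<Longrightarrow> z $ 2 > 0 \<Longrightarrow> norm z < \<delta> \<Longrightarrow> \<exists>T x. T > 0 \<and> x 0 = z \<and>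
       (\<forall>t\<in>{0..T}. (x has_vector_derivative X (x t)) (at t within {0..T})) \<and>
       (\<forall>t. 0 < t \<and> t < T \<longrightarrow> x t $ 1 > 0) \<and> x T $ 1 = 0 \<and> x T $ 2 \<le> 0"
  shows "has_two_parameter_family_of_periodic_solutions X"
proof -
  define U where "U = {u. u $ 1 > 0 \<and> norm (slice u) < \<delta>}"
  define family_member where "family_member u \<gamma> \<longleftrightarrow>
      global_solution X \<gamma> \<and> \<gamma> 0 = slice u \<and> periodic \<gamma> \<and> \<not> \<gamma> constant_on UNIV \<and>
      range \<gamma> \<inter> {z. z $ 1 = 0 \<and> z $ 2 > 0} = {slice u}" for u \<gamma>
  have ex: "\<exists>\<gamma>. family_member u \<gamma>" if u: "u \<in> U" for u
  proof -
    obtain T x where "T > 0" and x0: "x 0 = slice u"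
      and x: "\<And>t. t \<in> {0..T} \<Longrightarrow> (x has_vector_derivative X (x t)) (at t within {0..T})"
      and pos: "\<And>t. 0 < t \<Longrightarrow> t < T \<Longrightarrow> x t $ 1 > 0" and xT: "x T $ 1 = 0" "x T $ 2 \<le> 0"
      using returns[of "slice u"] u unfolding U_def by auto
    obtain \<gamma> where \<gamma>: "global_solution X \<gamma>" "\<And>t. \<gamma> (t + 2 * T) = \<gamma> t"
      "\<And>t. t \<in> {0..T} \<Longrightarrow> \<gamma> t = x t" and range: "range \<gamma> \<subseteq> x ` {0..T} \<union> flip ` x ` {0..T}"
      using reversible_orbit_closes_up[OF bounded_linear_flip rev \<open>T > 0\<close> x] x0 xT
      by (metis flip_fixed slice_nth(1))
    have \<gamma>0: "\<gamma> 0 = slice u" using \<gamma>(3)[of 0] x0 \<open>T > 0\<close> by simp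
    have "periodic \<gamma>"
      unfolding periodic_def using \<gamma>(2) \<open>T > 0\<close> by (intro exI[of _ "2 * T"]) simp
    moreover have "\<not> \<gamma> constant_on UNIV"
    proof
      assume "\<gamma> constant_on UNIV"
      then have "\<gamma> (T / 2) = \<gamma> 0" by (auto simp: constant_on_def)
      then show False using \<gamma>(3)[of "T / 2"] pos[of "T / 2"] \<gamma>0 \<open>T > 0\<close> by simp
    qed
    moreover have "range \<gamma> \<inter> {z. z $ 1 = 0 \<and> z $ 2 > 0} = {slice u}"
    proof (intro equalityI subsetI)
      fix z assume "z \<in> range \<gamma> \<inter> {z. z $ 1 = 0 \<and> z $ 2 > 0}"
      then have z: "z \<in> range \<gamma>" "z $ 1 = 0" "z $ 2 > 0" by auto
      obtain t where t: "t \<in> {0..T}" "z = x t \<or> z = flip (x t)" using range z(1) by blast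
      have "x t $ 1 = 0" "x t $ 2 > 0" using t z(2,3) by auto
      then have "t = 0" using pos[of t] t(1) xT by (cases "t = T") force+
      then show "z \<in> {slice u}" using t(2) x0 flip_fixed[of "slice u"] by auto
    next
      fix z assume "z \<in> {slice u}"
      then show "z \<in> range \<gamma> \<inter> {z. z $ 1 = 0 \<and> z $ 2 > 0}"
        using u \<gamma>0 rangeI[of \<gamma> 0] by (simp add: U_def)
    qed
    ultimately have "family_member u \<gamma>"
      using \<gamma>(1) \<gamma>0 by (simp add: family_member_def)
    then show ?thesis by (rule exI[of _ \<gamma>])
  qed
  define \<gamma> where "\<gamma> u = (SOME \<gamma>. family_member u \<gamma>)" for u
  have \<gamma>: "family_member u (\<gamma> u)" if "u \<in> U" for u
    unfolding \<gamma>_def by (rule someI_ex[OF ex[OF that]])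
  have "open U"
  proof -
    have "continuous_on UNIV slice" by (rule linear_continuous_on[OF bounded_linear_slice])
    then show ?thesis
      unfolding U_def
      by (intro open_Collect_conj open_Collect_less continuous_on_norm continuous_on_component
          continuous_on_const continuous_on_id)
  qed
  moreover have "U \<noteq> {}"
  proof -
    \<comment> \<open>A witness: half-way from the origin to the boundary of the half-disc.\<close>
    define u :: "real^2" where "u = vector [\<delta> / 2, 0]"
    have "norm (slice u) \<le> (\<Sum>i\<in>UNIV. \<bar>slice u $ i\<bar>)" by (rule norm_le_l1_cart)
    also have "\<dots> < \<delta>" using \<open>\<delta> > 0\<close> by (simp add: sum_3 u_def)
    finally have "u \<in> U" using \<open>\<delta> > 0\<close> by (simp add: U_def u_def)
    then show ?thesis by blast
  qed
  moreover have "immersion_on slice U"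
    unfolding immersion_on_def
    by (simp add: bounded_linear_imp_smooth_on[OF bounded_linear_slice]
        frechet_derivative_slice inj_slice)
  moreover have "transverse_on slice U X"
    unfolding transverse_on_def frechet_derivative_slice
  proof (intro ballI set_eqI iffI UNIV_I)
    fix u and y :: "real^3" assume "u \<in> U"
    define w where "w = X (slice u)"
    have "w $ 1 \<noteq> 0" using \<open>u \<in> U\<close> by (simp add: w_def X1 U_def)
    define c where "c = y $ 1 / w $ 1"
    have "y = c *\<^sub>R w + slice (vector [y $ 2 - c * w $ 2, y $ 3 - c * w $ 3])"
      using \<open>w $ 1 \<noteq> 0\<close> by (simp add: vec_eq_iff forall_3 c_def)
    also have "\<dots> \<in> span (insert w (range slice))"
      by (intro span_add span_scale span_base) auto
    finally show "y \<in> span (insert (X (slice u)) (range slice))" by (simp add: w_def)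
  qed
  moreover have "range (\<gamma> u) \<noteq> range (\<gamma> u')" if "u \<in> U" "u' \<in> U" "u \<noteq> u'" for u u'
  proof
    assume "range (\<gamma> u) = range (\<gamma> u')"
    then have "slice u = slice u'"
      using \<gamma>[OF that(1)] \<gamma>[OF that(2)] unfolding family_member_def by simp
    then show False using injD[OF inj_slice] that(3) by blast
  qed
  ultimately show ?thesis
    unfolding has_two_parameter_family_of_periodic_solutions_def
    using \<gamma> inj_on_subset[OF inj_slice subset_UNIV]
    by (intro exI[of _ U] exI[of _ slice] exI[of _ \<gamma>]) (simp add: family_member_def)
qed

section \<open>Lipschitz estimates on compact sets\<close>

text \<open>
  The constants of the Lipschitz estimates below are irrelevant, so they are hidden under
  existential quantifiers; in this form the lemmas combine as introduction rules along the formula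
  of a function. For products, compactness provides the bounds on the factors.
\<close>

lemma lipschitz_mult_compact:
  fixes f g :: "'a::metric_space \<Rightarrow> real"
  assumes "compact S" and f: "\<exists>L. L-lipschitz_on S f" and g: "\<exists>L. L-lipschitz_on S g"
  shows "\<exists>L. L-lipschitz_on S (\<lambda>x. f x * g x)"
proof -
  obtain L M where L: "L-lipschitz_on S f" and M: "M-lipschitz_on S g" using f g by blast
  have "bounded (f ` S)" "bounded (g ` S)"
    using \<open>compact S\<close> L M
    by (auto intro!: compact_imp_bounded compact_continuous_image lipschitz_on_continuous_on)
  then obtain A B where A: "\<And>x. x \<in> S \<Longrightarrow> \<bar>f x\<bar> \<le> A" and B: "\<And>x. x \<in> S \<Longrightarrow> \<bar>g x\<bar> \<le> B"
    unfolding bounded_iff by auto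
  have "(\<bar>A\<bar> * M + \<bar>B\<bar> * L)-lipschitz_on S (\<lambda>x. f x * g x)"
  proof (rule lipschitz_onI)
    fix x y assume xy: "x \<in> S" "y \<in> S"
    have "f x * g x - f y * g y = f x * (g x - g y) + g y * (f x - f y)" by (simp add: algebra_simps)
    then have "dist (f x * g x) (f y * g y) \<le> \<bar>f x\<bar> * dist (g x) (g y) + \<bar>g y\<bar> * dist (f x) (f y)"
      unfolding dist_real_def by (metis abs_mult abs_triangle_ineq)
    also have "\<dots> \<le> \<bar>A\<bar> * (M * dist x y) + \<bar>B\<bar> * (L * dist x y)"
      using A[OF xy(1)] B[OF xy(2)] lipschitz_onD[OF L xy] lipschitz_onD[OF M xy]
      by (intro add_mono mult_mono) auto
    finally show "dist (f x * g x) (f y * g y) \<le> (\<bar>A\<bar> * M + \<bar>B\<bar> * L) * dist x y"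
      by (simp add: algebra_simps)
  qed (use lipschitz_on_nonneg[OF L] lipschitz_on_nonneg[OF M] in simp)
  then show ?thesis ..
qed

lemma lipschitz_inverse:
  fixes f :: "'a::metric_space \<Rightarrow> real"
  assumes f: "\<exists>L. L-lipschitz_on S f" and "d > 0" and d: "\<And>x. x \<in> S \<Longrightarrow> d \<le> f x"
  shows "\<exists>L. L-lipschitz_on S (\<lambda>x. inverse (f x))"
proof -
  obtain L where L: "L-lipschitz_on S f" using f by blast
  have "(L / d\<^sup>2)-lipschitz_on S (\<lambda>x. inverse (f x))"
  proof (rule lipschitz_onI)
    fix x y assume xy: "x \<in> S" "y \<in> S"
    have pos: "f x > 0" "f y > 0" using d[OF xy(1)] d[OF xy(2)] \<open>d > 0\<close> by auto
    then have "inverse (f x) - inverse (f y) = (f y - f x) / (f x * f y)" by (simp add: field_simps)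
    then have "dist (inverse (f x)) (inverse (f y)) = dist (f x) (f y) / (f x * f y)"
      using pos by (simp add: dist_real_def abs_mult abs_minus_commute)
    also have "\<dots> \<le> (L * dist x y) / d\<^sup>2"
      using lipschitz_onD[OF L xy] d xy \<open>d > 0\<close> pos
      by (intro frac_le) (auto simp: power2_eq_square lipschitz_on_nonneg[OF L] intro!: mult_mono)
    finally show "dist (inverse (f x)) (inverse (f y)) \<le> L / d\<^sup>2 * dist x y" by simp
  qed (use lipschitz_on_nonneg[OF L] in simp)
  then show ?thesis ..
qed

lemma lipschitz_sin:
  fixes f :: "'a::metric_space \<Rightarrow> real"
  assumes "\<exists>L. L-lipschitz_on S f"
  shows "\<exists>L. L-lipschitz_on S (\<lambda>x. sin (f x))"
proof -
  have "1-lipschitz_on UNIV (sin :: real \<Rightarrow> real)"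
  proof (rule lipschitz_onI)
    fix x y :: real
    have "\<bar>sin x - sin y\<bar> = 2 * (\<bar>sin ((x - y) / 2)\<bar> * \<bar>cos ((x + y) / 2)\<bar>)"
      by (simp add: sin_diff_sin abs_mult)
    also have "\<dots> \<le> 2 * (\<bar>(x - y) / 2\<bar> * 1)"
      by (intro mult_left_mono mult_mono abs_sin_x_le_abs_x abs_cos_le_one) auto
    finally show "dist (sin x) (sin y) \<le> 1 * dist x y" by (simp add: dist_real_def)
  qed simp
  then show ?thesis
    using assms lipschitz_on_compose2[of _ S f 1 sin] lipschitz_on_subset[of 1 UNIV sin "f ` S"]
    by blast
qed

lemma lipschitz_const: "\<exists>L. L-lipschitz_on S (\<lambda>x. c)"
  using lipschitz_on_constant by blast

lemma lipschitz_add: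
  fixes f g :: "'a::metric_space \<Rightarrow> real"
  shows "\<exists>L. L-lipschitz_on S f \<Longrightarrow> \<exists>L. L-lipschitz_on S g \<Longrightarrow> \<exists>L. L-lipschitz_on S (\<lambda>x. f x + g x)"
  using lipschitz_on_add by blast

lemma lipschitz_diff:
  fixes f g :: "'a::metric_space \<Rightarrow> real"
  shows "\<exists>L. L-lipschitz_on S f \<Longrightarrow> \<exists>L. L-lipschitz_on S g \<Longrightarrow> \<exists>L. L-lipschitz_on S (\<lambda>x. f x - g x)"
  using lipschitz_on_diff by blast

lemma lipschitz_cos:
  fixes f :: "'a::metric_space \<Rightarrow> real"
  assumes "\<exists>L. L-lipschitz_on S f"
  shows "\<exists>L. L-lipschitz_on S (\<lambda>x. cos (f x))"
  using lipschitz_sin[OF lipschitz_diff[OF lipschitz_const[of S "pi / 2"] assms]]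
  by (simp add: cos_sin_eq)

lemma lipschitz_vec_nth: "\<exists>L. L-lipschitz_on S (\<lambda>x::real^'n. x $ i)"
  by (intro exI[of _ 1] lipschitz_onI) (auto simp: dist_vec_nth_le)

lemma lipschitz_vec_componentwise:
  fixes f :: "'a::metric_space \<Rightarrow> real^'n"
  assumes "\<And>i. \<exists>L. L-lipschitz_on S (\<lambda>x. f x $ i)"
  shows "\<exists>L. L-lipschitz_on S f"
proof -
  obtain L where L: "\<And>i. (L i)-lipschitz_on S (\<lambda>x. f x $ i)" using assms by metis
  have "(\<Sum>i\<in>UNIV. L i)-lipschitz_on S f"
  proof (rule lipschitz_onI)
    fix x y assume xy: "x \<in> S" "y \<in> S"
    have "dist (f x) (f y) \<le> (\<Sum>i\<in>UNIV. \<bar>(f x - f y) $ i\<bar>)"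
      unfolding dist_norm by (rule norm_le_l1_cart)
    also have "\<dots> \<le> (\<Sum>i\<in>UNIV. L i * dist x y)"
      using lipschitz_onD[OF L xy] by (intro sum_mono) (simp add: dist_real_def)
    finally show "dist (f x) (f y) \<le> (\<Sum>i\<in>UNIV. L i) * dist x y" by (simp add: sum_distrib_right)
  qed (use L lipschitz_on_nonneg in \<open>auto intro!: sum_nonneg\<close>)
  then show ?thesis ..
qed

section \<open>Estimates for the pendulum\<close>

definition mass_det :: "ziegler \<Rightarrow> real \<Rightarrow> real" where
  "mass_det p \<phi> = A11 p * A22 p \<phi> - (A12 p \<phi>)\<^sup>2"

lemma ziegler_field_nth:
  "ziegler_field p k F z $ 1 = z $ 2"
  "ziegler_field p k F z $ 2 = (A22 p (z $ 1) * r1 p k (z $ 1) (z $ 3)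
     - A12 p (z $ 1) * r2 p F (z $ 1) (z $ 2) (z $ 3)) / mass_det p (z $ 1)"
  "ziegler_field p k F z $ 3 = (A11 p * r2 p F (z $ 1) (z $ 2) (z $ 3)
     - A12 p (z $ 1) * r1 p k (z $ 1) (z $ 3)) / mass_det p (z $ 1)"
  by (simp_all add: ziegler_field_def mass_det_def Let_def)

text \<open>
  The coefficients of the mass matrix are even in \<open>\<phi>1\<close>, the forces \<open>r1\<close>, \<open>r2\<close> are odd.
\<close>

lemma ziegler_field_flip: "ziegler_field p k F (flip z) = - flip (ziegler_field p k F z)"
proof -
  have "A12 p (- a) = A12 p a" "A22 p (- a) = A22 p a" "mass_det p (- a) = mass_det p a"
    "r1 p k (- a) b = - r1 p k a b" "r2 p F (- a) b c = - r2 p F a b c" for a b c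
    by (simp_all add: A12_def A22_def mass_det_def r1_def r2_def algebra_simps)
  then show ?thesis
    by (simp add: vec_eq_iff forall_3 ziegler_field_nth minus_divide_left algebra_simps)
qed

lemma ziegler_field_0: "ziegler_field p k F 0 = 0"
  by (simp add: vec_eq_iff forall_3 ziegler_field_nth r1_def r2_def)

locale ziegler_parameters =
  fixes p :: ziegler
  assumes pos: "m1 p > 0" "m2 p > 0" "m3 p > 0" "l1 p > 0" "l2 p > 0" "l3 p > 0"
begin

abbreviation "J \<equiv> A11 p"
abbreviation "M \<equiv> m1 p + m2 p + m3 p"
abbreviation "\<mu> \<equiv> m1 p * l1 p - m3 p * l3 p"

lemma J_pos: "J > 0"
  using pos by (auto simp: A11_def intro!: add_pos_pos)

lemma mass_det_eq: "mass_det p \<phi> = (l2 p)\<^sup>2 * (J * M - \<mu>\<^sup>2 * (cos \<phi>)\<^sup>2)"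
  by (simp add: mass_det_def A12_def A22_def A11_def power2_eq_square algebra_simps)

text \<open>
  The Cauchy-Schwarz inequality for the vectors \<open>(sqrt m1 * l1, sqrt m3 * l3)\<close> and
  \<open>(sqrt m1, - sqrt m3)\<close> gives \<open>\<mu>\<^sup>2 \<le> J * (m1 + m3)\<close>; the mass \<open>m2\<close> is what remains of \<open>M\<close>.
\<close>

lemma mass_det_lower: "mass_det p \<phi> \<ge> (l2 p)\<^sup>2 * (J * m2 p)"
proof -
  have "\<mu>\<^sup>2 * (cos \<phi>)\<^sup>2 \<le> \<mu>\<^sup>2 * 1"
    by (intro mult_left_mono) (auto simp: abs_square_le_1)
  also have "\<dots> \<le> J * (m1 p + m3 p)"
  proof -
    have "J * (m1 p + m3 p) - \<mu>\<^sup>2 = m1 p * m3 p * (l1 p + l3 p)\<^sup>2"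
      by (simp add: A11_def power2_eq_square algebra_simps)
    also have "\<dots> \<ge> 0" using pos by simp
    finally show ?thesis by simp
  qed
  finally have "J * m2 p \<le> J * M - \<mu>\<^sup>2 * (cos \<phi>)\<^sup>2" by (simp add: algebra_simps)
  then show ?thesis unfolding mass_det_eq by (intro mult_left_mono) auto
qed

lemma mass_det_pos: "mass_det p \<phi> > 0"
proof -
  have "(l2 p)\<^sup>2 * (J * m2 p) > 0" using J_pos pos by simp
  then show ?thesis using mass_det_lower[of \<phi>] by linarith
qed

lemma mass_det_upper: "mass_det p \<phi> \<le> (l2 p)\<^sup>2 * (J * M)"
  unfolding mass_det_eq by (intro mult_left_mono) auto

lemma A22_lower: "A22 p \<phi> \<ge> m2 p * (l2 p)\<^sup>2"
proof -
  have "J * (m2 p * (l2 p)\<^sup>2) \<le> mass_det p \<phi>"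
    using mass_det_lower by (simp add: mult_ac)
  also have "\<dots> \<le> J * A22 p \<phi>" by (simp add: mass_det_def)
  finally show ?thesis using J_pos by simp
qed

abbreviation "C \<equiv> M * (l2 p)\<^sup>2 + J + 2 * \<bar>\<mu>\<bar> * l2 p"

lemma C_pos: "C > 0"
  using J_pos pos by (intro add_pos_nonneg) auto

lemma abs_A12_le: "\<bar>A12 p \<phi>\<bar> \<le> C" and abs_A22_le: "\<bar>A22 p \<phi>\<bar> \<le> C"
proof -
  have "\<bar>\<mu> * l2 p * cos \<phi>\<bar> \<le> \<bar>\<mu>\<bar> * l2 p"
    using pos abs_cos_le_one[of \<phi>] by (simp add: abs_mult mult_left_le)
  moreover have "M * (l2 p)\<^sup>2 \<ge> 0" using pos by simp
  moreover have "A12 p \<phi> = J + \<mu> * l2 p * cos \<phi>"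
    "A22 p \<phi> = M * (l2 p)\<^sup>2 + J + 2 * (\<mu> * l2 p * cos \<phi>)"
    by (simp_all add: A12_def A22_def A11_def)
  moreover note J_pos
  ultimately show "\<bar>A12 p \<phi>\<bar> \<le> C" "\<bar>A22 p \<phi>\<bar> \<le> C"
    unfolding mult.assoc by linarith+
qed

lemma ziegler_field_lipschitz:
  assumes "compact S"
  shows "\<exists>L. L-lipschitz_on S (ziegler_field p k F)"
proof -
  note intros = lipschitz_mult_compact[OF assms] lipschitz_sin lipschitz_cos lipschitz_add
    lipschitz_diff lipschitz_const lipschitz_vec_nth
  have A12: "\<exists>L. L-lipschitz_on S (\<lambda>z. A12 p (z $ 1))"
    and A22: "\<exists>L. L-lipschitz_on S (\<lambda>z. A22 p (z $ 1))"
    and r1: "\<exists>L. L-lipschitz_on S (\<lambda>z. r1 p k (z $ 1) (z $ 3))"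
    and r2: "\<exists>L. L-lipschitz_on S (\<lambda>z. r2 p F (z $ 1) (z $ 2) (z $ 3))"
    unfolding A12_def A22_def r1_def r2_def power2_eq_square by (intro intros)+
  have "\<exists>L. L-lipschitz_on S (\<lambda>z. mass_det p (z $ 1))"
    unfolding mass_det_def power2_eq_square by (intro intros A12 A22)
  then have D: "\<exists>L. L-lipschitz_on S (\<lambda>z. inverse (mass_det p (z $ 1)))"
    by (rule lipschitz_inverse[OF _ _ mass_det_lower]) (use J_pos pos in simp)
  have "\<forall>i. \<exists>L. L-lipschitz_on S (\<lambda>z. ziegler_field p k F z $ i)"
    unfolding forall_3 ziegler_field_nth divide_inverse
    by (intro conjI intros A12 A22 r1 r2 D)
  then show ?thesis by (intro lipschitz_vec_componentwise) blast
qed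

text \<open>
  The numerator of the acceleration of \<open>\<phi>1\<close> is \<open>G * sin \<phi>1 - A22 * k * \<phi>1\<close>, where \<open>G\<close> has a
  part linear in \<open>F\<close> and a part quadratic in the velocities. With \<open>a = m2 * l2\<^sup>2 * k\<close> the spring term is at least \<open>a * \<phi>1\<close>. The
  bounds \<open>\<epsilon>\<close> on \<open>F\<close> and \<open>\<rho>\<close> on the state are chosen so that the two parts of \<open>G\<close> contribute at
  most \<open>a / 4\<close> each, which leaves half of the spring force; \<open>\<omega>\<^sup>2\<close> is this half divided by the upper
  bound on the determinant.
\<close>

lemma restoring_acceleration:
  assumes "k > 0"
  obtains \<epsilon> \<rho> \<omega> where "\<epsilon> > 0" "\<rho> > 0" "\<omega> > 0"
    "\<And>F z. \<bar>F\<bar> < \<epsilon> \<Longrightarrow> z \<in> cball 0 \<rho> \<Longrightarrow> z $ 1 \<ge> 0 \<Longrightarrow> ziegler_field p k F z $ 2 \<le> - \<omega>\<^sup>2 * z $ 1"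
proof -
  define a where "a = m2 p * (l2 p)\<^sup>2 * k"
  have "a > 0" using pos \<open>k > 0\<close> by (simp add: a_def)
  define c where "c = C * \<bar>\<mu>\<bar> * l2 p"
  have "c \<ge> 0" using C_pos pos by (simp add: c_def)
  define \<epsilon> where "\<epsilon> = a / (4 * (C * l2 p))"
  \<comment> \<open>The summand \<open>1\<close> keeps the denominator positive in the symmetric case \<open>\<mu> = 0\<close>.\<close>
  define \<rho> where "\<rho> = sqrt (a / (16 * c + 1))"
  define \<omega> where "\<omega> = sqrt (a / 2 / ((l2 p)\<^sup>2 * (J * M)))"
  have "\<epsilon> > 0" using \<open>a > 0\<close> C_pos pos by (simp add: \<epsilon>_def)
  have \<rho>: "\<rho> > 0" "\<rho>\<^sup>2 = a / (16 * c + 1)" using \<open>a > 0\<close> \<open>c \<ge> 0\<close> by (simp_all add: \<rho>_def)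
  have "(l2 p)\<^sup>2 * (J * M) > 0" using J_pos pos by simp
  then have \<omega>: "\<omega> > 0" "\<omega>\<^sup>2 = a / 2 / ((l2 p)\<^sup>2 * (J * M))"
    using \<open>a > 0\<close> by (simp_all add: \<omega>_def)
  have small: "4 * c * \<rho>\<^sup>2 \<le> a / 4"
    unfolding \<rho>(2) using \<open>a > 0\<close> \<open>c \<ge> 0\<close> by (simp add: field_simps)
  have "ziegler_field p k F z $ 2 \<le> - \<omega>\<^sup>2 * z $ 1"
    if F: "\<bar>F\<bar> < \<epsilon>" and z: "z \<in> cball 0 \<rho>" and "z $ 1 \<ge> 0" for F z
  proof -
    define q v w where "q = z $ 1" and "v = z $ 2" and "w = z $ 3"
    have vw: "\<bar>v\<bar> \<le> \<rho>" "\<bar>w\<bar> \<le> \<rho>"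
      using z component_le_norm_cart[of z] unfolding v_def w_def by (auto intro: order_trans)
    define G where "G = A12 p q * (F * l2 p) - A22 p q * (\<mu> * l2 p * w\<^sup>2)
      - A12 p q * (\<mu> * l2 p * (v * (v + 2 * w)))"
    have "\<bar>G\<bar> \<le> C * (\<bar>F\<bar> * l2 p) + C * (\<bar>\<mu>\<bar> * l2 p * \<rho>\<^sup>2) + C * (\<bar>\<mu>\<bar> * l2 p * (3 * \<rho>\<^sup>2))"
    proof -
      have 1: "\<bar>A12 p q * (F * l2 p)\<bar> \<le> C * (\<bar>F\<bar> * l2 p)"
        unfolding abs_mult using pos C_pos by (intro mult_mono abs_A12_le) auto
      have 2: "\<bar>A22 p q * (\<mu> * l2 p * w\<^sup>2)\<bar> \<le> C * (\<bar>\<mu>\<bar> * l2 p * \<rho>\<^sup>2)"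
        unfolding abs_mult using pos vw C_pos
        by (intro mult_mono abs_A22_le) (auto simp: abs_le_square_iff[symmetric])
      have "\<bar>v + 2 * w\<bar> \<le> 3 * \<rho>" using vw by linarith
      then have "\<bar>v\<bar> * \<bar>v + 2 * w\<bar> \<le> \<rho> * (3 * \<rho>)" using vw by (intro mult_mono) auto
      then have vw2: "\<bar>v * (v + 2 * w)\<bar> \<le> 3 * \<rho>\<^sup>2"
        by (simp add: abs_mult power2_eq_square)
      have "\<bar>\<mu> * l2 p * (v * (v + 2 * w))\<bar> = \<bar>\<mu>\<bar> * l2 p * \<bar>v * (v + 2 * w)\<bar>"
        using pos by (simp add: abs_mult)
      also have "\<dots> \<le> \<bar>\<mu>\<bar> * l2 p * (3 * \<rho>\<^sup>2)"
        using pos by (intro mult_left_mono vw2) simp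
      finally have 3: "\<bar>A12 p q * (\<mu> * l2 p * (v * (v + 2 * w)))\<bar> \<le> C * (\<bar>\<mu>\<bar> * l2 p * (3 * \<rho>\<^sup>2))"
        unfolding abs_mult[of "A12 p q"] using C_pos by (intro mult_mono abs_A12_le) auto
      show ?thesis using 1 2 3 unfolding G_def by linarith
    qed
    also have "\<dots> = \<bar>F\<bar> * (C * l2 p) + 4 * c * \<rho>\<^sup>2" by (simp add: c_def algebra_simps)
    also have "\<dots> \<le> \<epsilon> * (C * l2 p) + a / 4"
      using F small C_pos pos by (intro add_mono mult_right_mono) auto
    also have "\<dots> = a / 2" using C_pos pos by (simp add: \<epsilon>_def)
    finally have G: "\<bar>G\<bar> \<le> a / 2" .
    have "q \<ge> 0" using that by (simp add: q_def)
    have "A22 p q * r1 p k q w - A12 p q * r2 p F q v w = G * sin q - A22 p q * k * q"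
    proof -
      have "A * (- k * q - \<nu> * l * w\<^sup>2 * s) - B * (- F * l * s + \<nu> * l * v * (v + 2 * w) * s)
          = (B * (F * l) - A * (\<nu> * l * w\<^sup>2) - B * (\<nu> * l * (v * (v + 2 * w)))) * s - A * k * q"
        for A B \<nu> l s :: real
        by (simp add: algebra_simps)
      then show ?thesis unfolding G_def r1_def r2_def .
    qed
    moreover have "G * sin q \<le> a / 2 * q"
    proof -
      have "G * sin q \<le> \<bar>G\<bar> * \<bar>sin q\<bar>" by (metis abs_ge_self abs_mult)
      also have "\<dots> \<le> a / 2 * q"
        using G abs_sin_x_le_abs_x[of q] \<open>q \<ge> 0\<close> by (intro mult_mono) auto
      finally show ?thesis .
    qed
    moreover have "a * q \<le> A22 p q * k * q"
      unfolding a_def using A22_lower \<open>k > 0\<close> \<open>q \<ge> 0\<close> by (intro mult_right_mono) auto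
    ultimately have num: "A22 p q * r1 p k q w - A12 p q * r2 p F q v w \<le> - (a / 2 * q)"
      by linarith
    have "\<omega>\<^sup>2 * q \<le> a / 2 / mass_det p q * q"
      unfolding \<omega>(2) using mass_det_upper[of q] mass_det_pos[of q] \<open>a > 0\<close> \<open>q \<ge> 0\<close>
      by (intro mult_right_mono frac_le) linarith+
    moreover have "(A22 p q * r1 p k q w - A12 p q * r2 p F q v w) / mass_det p q \<le> - (a / 2 * q) / mass_det p q"
      using num mass_det_pos by (intro divide_right_mono) (auto simp: less_imp_le)
    ultimately show ?thesis by (simp add: ziegler_field_nth q_def v_def w_def)
  qed
  then show thesis using that \<open>\<epsilon> > 0\<close> \<rho>(1) \<omega>(1) by blast
qed

end

section \<open>The family of periodic solutions\<close>

theorem proposition9: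
  fixes p :: ziegler
  assumes "m1 p > 0" "m2 p > 0" "m3 p > 0" "l1 p > 0" "l2 p > 0" "l3 p > 0"
  shows "\<exists>K1::real. \<forall>k1>K1. \<exists>\<epsilon>>0. \<forall>F::real. \<bar>F\<bar> < \<epsilon> \<longrightarrow>
           has_two_parameter_family_of_periodic_solutions (ziegler_field p k1 F)"
proof (rule exI[of _ 0], intro allI impI)
  fix k1 :: real assume "k1 > 0"
  interpret ziegler_parameters p using assms by unfold_locales
  obtain \<epsilon> \<rho> \<omega> where "\<epsilon> > 0" "\<rho> > 0" "\<omega> > 0" and restoring:
    "\<And>F z. \<bar>F\<bar> < \<epsilon> \<Longrightarrow> z \<in> cball 0 \<rho> \<Longrightarrow> z $ 1 \<ge> 0 \<Longrightarrow> ziegler_field p k1 F z $ 2 \<le> - \<omega>\<^sup>2 * z $ 1"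
    by (rule restoring_acceleration[OF \<open>k1 > 0\<close>]) (rule that)
  have "has_two_parameter_family_of_periodic_solutions (ziegler_field p k1 F)" if F: "\<bar>F\<bar> < \<epsilon>" for F
  proof -
    define X where "X = ziegler_field p k1 F"
    \<comment> \<open>Composition with the nearest-point projection \<open>P\<close> truncates the field outside the ball.\<close>
    define P where "P = closest_point (cball (0 :: real^3) \<rho>)"
    have P_in: "P z \<in> cball 0 \<rho>" for z
      unfolding P_def using \<open>\<rho> > 0\<close> by (intro closest_point_in_set) auto
    have P_id: "P z = z" if "z \<in> cball 0 \<rho>" for z
      unfolding P_def using that by (rule closest_point_self)
    have P_lip: "1-lipschitz_on UNIV P"
      unfolding P_def using \<open>\<rho> > 0\<close> by (intro lipschitz_onI) (auto intro!: closest_point_lipschitz)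
    obtain L0 where L0: "L0-lipschitz_on (cball 0 \<rho>) X"
      using ziegler_field_lipschitz[OF compact_cball] unfolding X_def by blast
    have "L0-lipschitz_on (P ` UNIV) X"
      by (rule lipschitz_on_subset[OF L0]) (use P_in in blast)
    then have "(L0 * 1)-lipschitz_on UNIV (\<lambda>z. X (P z))"
      by (rule lipschitz_on_compose2[OF P_lip])
    then have L: "(L0 + 1)-lipschitz_on UNIV (\<lambda>z. X (P z))"
      by (rule lipschitz_on_mono[OF _ subset_refl]) simp
    have "L0 + 1 > 0" using lipschitz_on_nonneg[OF L0] by simp
    have XP0: "X (P 0) = 0" using P_id[of 0] \<open>\<rho> > 0\<close> by (simp add: X_def ziegler_field_0)
    define T where "T = pi / \<omega>"
    have "T \<ge> 0" using \<open>\<omega> > 0\<close> by (simp add: T_def)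
    \<comment> \<open>Solutions of the truncated system that start within \<open>\<delta>\<close> of the origin cannot leave the
        ball before the time \<open>T\<close>.\<close>
    define \<delta> where "\<delta> = \<rho> / (2 * exp (2 * (L0 + 1) * T))"
    have "\<delta> > 0" using \<open>\<rho> > 0\<close> by (simp add: \<delta>_def)
    show ?thesis
      unfolding X_def[symmetric]
    proof (rule two_parameter_family_if_returns[of X \<delta>])
      show "X z $ 1 = z $ 2" for z by (simp add: X_def ziegler_field_nth)
      show "X (flip z) = - flip (X z)" for z by (simp add: X_def ziegler_field_flip)
      show "\<delta> > 0" by fact
      fix z :: "real^3" assume z: "z $ 1 = 0" "z $ 2 > 0" "norm z < \<delta>"
      obtain x where x0: "x 0 = z"
        and x: "\<And>t. t \<in> {0..T} \<Longrightarrow> (x has_vector_derivative X (P (x t))) (at t within {0..T})"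
        and bound: "\<And>t. t \<in> {0..T} \<Longrightarrow> norm (x t) \<le> 2 * norm z * exp (2 * (L0 + 1) * t)"
        by (rule lipschitz_ode_solution[OF L \<open>L0 + 1 > 0\<close> XP0 \<open>T \<ge> 0\<close>, of z]) (rule that)
      have in_ball: "x t \<in> cball 0 \<rho>" if t: "t \<in> {0..T}" for t
      proof -
        have "norm (x t) \<le> 2 * norm z * exp (2 * (L0 + 1) * t)" by (rule bound[OF t])
        also have "\<dots> \<le> 2 * \<delta> * exp (2 * (L0 + 1) * T)"
          using t z(3) \<open>\<delta> > 0\<close> \<open>L0 + 1 > 0\<close> by (intro mult_mono) auto
        also have "\<dots> = \<rho>" by (simp add: \<delta>_def)
        finally show ?thesis by simp
      qed
      have sol: "(x has_vector_derivative X (x t)) (at t within {0..T})" if "t \<in> {0..T}" for t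
        using x[OF that] P_id[OF in_ball[OF that]] by simp
      have comp: "((\<lambda>t. x t $ i) has_real_derivative X (x t) $ i) (at t within {0..T})"
        if "t \<in> {0..T}" for t i
        using bounded_linear.has_vector_derivative[OF bounded_linear_vec_nth sol[OF that]]
        by (simp add: has_real_derivative_iff_has_vector_derivative)
      obtain S where S: "S > 0" "S \<le> T" "x S $ 1 = 0" "\<And>t. 0 < t \<Longrightarrow> t < S \<Longrightarrow> x t $ 1 > 0" "x S $ 2 \<le> 0"
      proof (rule first_return_before_half_period[OF \<open>\<omega> > 0\<close> T_def,
            of "\<lambda>t. x t $ 1" "\<lambda>t. x t $ 2" "\<lambda>t. X (x t) $ 2"])
        show "((\<lambda>t. x t $ 1) has_real_derivative x t $ 2) (at t within {0..T})" if "t \<in> {0..T}" for t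
          using comp[OF that, of 1] by (simp add: X_def ziegler_field_nth)
        show "((\<lambda>t. x t $ 2) has_real_derivative X (x t) $ 2) (at t within {0..T})"
          if "t \<in> {0..T}" for t using comp[OF that] .
        show "X (x t) $ 2 \<le> - \<omega>\<^sup>2 * x t $ 1" if "t \<in> {0..T}" "x t $ 1 \<ge> 0" for t
          unfolding X_def by (rule restoring[OF F in_ball[OF that(1)] that(2)])
      qed (use x0 z in auto)
      have "(x has_vector_derivative X (x t)) (at t within {0..S})" if "t \<in> {0..S}" for t
        using has_vector_derivative_within_subset[OF sol, of t "{0..S}"] that S(2) by auto
      then show "\<exists>S x. S > 0 \<and> x 0 = z \<and>
         (\<forall>t\<in>{0..S}. (x has_vector_derivative X (x t)) (at t within {0..S})) \<and>
         (\<forall>t. 0 < t \<and> t < S \<longrightarrow> x t $ 1 > 0) \<and> x S $ 1 = 0 \<and> x S $ 2 \<le> 0"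
        using S x0 by (intro exI[of _ S] exI[of _ x]) auto
    qed
  qed
  then show "\<exists>\<epsilon>>0. \<forall>F::real. \<bar>F\<bar> < \<epsilon> \<longrightarrow>
      has_two_parameter_family_of_periodic_solutions (ziegler_field p k1 F)"
    using \<open>\<epsilon> > 0\<close> by blast
qed

end
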